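(* Let $\mathscr{C}\in\mathbb{R}^{n_1\times n_2\times n_3}$ and $\mathscr{D}\in\mathbb{R}^{n_1\times l\times n_3}$. (i) For an arbitrary initial tensor $\mathscr{X}_1\in\mathbb{R}^{n_2\times l\times n_3}$, the sequence $\{\mathscr{X}_k\}$ generated by Algorithm E (described in the context) reaches a solution of the least-squares problem $\min_{\mathscr{X}\in\mathbb{R}^{n_2\times l\times n_3}}\|\mathscr{C}\star\mathscr{X}-\mathscr{D}\|$ in at most $n_2 l n_3$ iteration steps (updates of the iterate starting from $\mathscr{X}_1$); that is, there is $k\in\{1,\dots,n_2 l n_3+1\}$ such that $\mathscr{X}_k$ is generated and is a minimizer. (ii) If moreover $\mathscr{X}_1=\mathscr{C}^T\star\mathscr{C}\star\mathscr{H}$ for some arbitrary $\mathscr{H}\in\mathbb{R}^{n_2\times l\times n_3}$ (in particular, if $\mathscr{X}_1=\mathscr{O}$), then the solution $\tilde{\mathscr{X}}$ generated by Algorithm E is the minimal Frobenius norm solution of $\min_{\mathscr{X}}\|\mathscr{C}\star\mathscr{X}-\mathscr{D}\|$.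
   Context: Third-order tensors: for $\mathscr{A}\in\mathbb{R}^{m\times p\times q}$, $\mathscr{A}^{(k)}=\mathscr{A}(:,:,k)\in\mathbb{R}^{m\times p}$ denotes its $k$-th frontal slice, $k=1,\dots,q$. T-product: for $\mathscr{A}\in\mathbb{R}^{m\times p\times q}$, $\mathscr{B}\in\mathbb{R}^{p\times s\times q}$, $\mathscr{A}\star\mathscr{B}\in\mathbb{R}^{m\times s\times q}$ is defined by $(\mathscr{A}\star\mathscr{B})^{(k)}=\sum_{j=1}^{q}\mathscr{A}^{(k-j+1)}\mathscr{B}^{(j)}$, slice indices of $\mathscr{A}$ taken modulo $q$ in $\{1,\dots,q\}$. Transpose: $\mathscr{A}^T\in\mathbb{R}^{p\times m\times q}$ is obtained by transposing each frontal slice and reversing the order of the transposed slices $2,\dots,q$. Inner product: $\langle\mathscr{A},\mathscr{B}\rangle=\sum_{i,j,k}a_{ijk}b_{ijk}=Tr((\mathscr{B}^T\star\mathscr{A})^{(1)})$ with $Tr$ the matrix trace; $\|\mathscr{A}\|=\sqrt{\langle\mathscr{A},\mathscr{A}\rangle}$ is the Frobenius norm. $\mathscr{O}$ is the zero tensor. Algorithm E (exact arithmetic), with input $\mathscr{C},\mathscr{D},\mathscr{X}_1$: set $\mathscr{R}_1=\mathscr{C}^T\star\mathscr{D}-\mathscr{C}^T\star\mathscr{C}\star\mathscr{X}_1$, $\mathscr{P}_1=\mathscr{C}^T\star\mathscr{C}\star\mathscr{R}_1$, $\mathscr{Q}_1=\mathscr{P}_1$. For $k=2,3,\dots$: stop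 (with output $\tilde{\mathscr{X}}=\mathscr{X}_{k-1}$) if $\mathscr{R}_{k-1}=\mathscr{O}$; otherwise set $$\mathscr{X}_k=\mathscr{X}_{k-1}+\frac{\|\mathscr{R}_{k-1}\|^2}{\|\mathscr{Q}_{k-1}\|^2}\mathscr{Q}_{k-1},\quad \mathscr{R}_k=\mathscr{C}^T\star\mathscr{D}-\mathscr{C}^T\star\mathscr{C}\star\mathscr{X}_k,\quad \mathscr{P}_k=\mathscr{C}^T\star\mathscr{C}\star\mathscr{R}_k,$$ $$\mathscr{Q}_k=\mathscr{P}_k-\frac{Tr((\mathscr{P}_k^T\star\mathscr{Q}_{k-1})^{(1)})}{\|\mathscr{Q}_{k-1}\|^2}\mathscr{Q}_{k-1}.$$ *)

theory Defs
  imports "HOL-Analysis.Analysis" "Berlekamp_Zassenhaus.Finite_Field"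
begin

text \<open>
  A tensor of size m x p x q is the vector of its frontal slices, each slice being an m x p matrix.
  The slices are indexed by the residues modulo q = CARD('q): the slice numbered k in 1, ..., q is
  \<open>A $ of_int_mod_ring (int k - 1)\<close>, so the first slice is \<open>A $ 0\<close>, and arithmetic on slice indices
  is arithmetic modulo q. Zero tensor, inner product and norm are those of the library; the norm is
  the Frobenius norm, see \<open>inner_tensor\<close> and \<open>norm_tensor\<close> below.
\<close>

type_synonym ('m, 'p, 'q) tensor = "real ^ 'p ^ 'm ^ 'q mod_ring"

text \<open>With residues for the 1-based indices k and j, the index k - j + 1 becomes k - j.\<close>

definition tprod ::
    "('m::finite, 'p::finite, 'q::finite) tensor \<Rightarrow> ('p, 's::finite, 'q) tensor \<Rightarrow> ('m, 's, 'q) tensor"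
    (infixl \<open>\<star>\<close> 70) where
  "A \<star> B = (\<chi> k. \<Sum>j\<in>UNIV. A $ (k - j) ** B $ j)"

text \<open>Negating the residues fixes the first slice and reverses the order of the others.\<close>

definition ttranspose ::
    "('m::finite, 'p::finite, 'q::finite) tensor \<Rightarrow> ('p, 'm, 'q) tensor" where
  "ttranspose A = (\<chi> k. transpose (A $ (- k)))"

lemma tprod_slice:
  fixes A :: "('m::finite, 'p::finite, 'q::finite) tensor" and B :: "('p, 's::finite, 'q) tensor"
  shows "(A \<star> B) $ of_int_mod_ring k =
    (\<Sum>j\<in>{0..<int CARD('q)}. A $ of_int_mod_ring (k - j) ** B $ of_int_mod_ring j)"
proof -
  have *: "of_int_mod_ring k - of_int_mod_ring j = (of_int_mod_ring (k - j) :: 'q mod_ring)" for j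
    by transfer (simp add: mod_simps)
  have bij: "bij_betw (of_int_mod_ring :: int \<Rightarrow> 'q mod_ring) {0..<int CARD('q)} UNIV"
    by (rule bij_betw_byWitness[where f' = to_int_mod_ring])
       (use range_to_int_mod_ring[where ?'a = 'q] in auto)
  show ?thesis
    unfolding tprod_def by (simp add: sum.reindex_bij_betw[OF bij, symmetric] *)
qed

lemma inner_tensor:
  fixes A B :: "('m::finite, 'p::finite, 'q::finite) tensor"
  shows "A \<bullet> B = (\<Sum>k\<in>UNIV. \<Sum>i\<in>UNIV. \<Sum>j\<in>UNIV. A $ k $ i $ j * B $ k $ i $ j)"
  by (simp add: inner_vec_def)

lemma norm_tensor:
  fixes A :: "('m::finite, 'p::finite, 'q::finite) tensor"
  shows "norm A = sqrt (\<Sum>k\<in>UNIV. \<Sum>i\<in>UNIV. \<Sum>j\<in>UNIV. (A $ k $ i $ j)\<^sup>2)"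
  by (simp add: norm_eq_sqrt_inner inner_tensor power2_eq_square)

lemma inner_tensor_trace:
  fixes A B :: "('m::finite, 'p::finite, 'q::finite) tensor"
  shows "A \<bullet> B = trace ((ttranspose B \<star> A) $ 0)"
proof -
  have "trace ((ttranspose B \<star> A) $ 0) =
      (\<Sum>j\<in>UNIV. \<Sum>k\<in>UNIV. \<Sum>i\<in>UNIV. B $ k $ i $ j * A $ k $ i $ j)"
    by (simp add: trace_def tprod_def ttranspose_def matrix_matrix_mult_def transpose_def)
  also have "\<dots> = (\<Sum>k\<in>UNIV. \<Sum>j\<in>UNIV. \<Sum>i\<in>UNIV. B $ k $ i $ j * A $ k $ i $ j)"
    by (rule sum.swap)
  also have "\<dots> = (\<Sum>k\<in>UNIV. \<Sum>i\<in>UNIV. \<Sum>j\<in>UNIV. B $ k $ i $ j * A $ k $ i $ j)"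
    by (rule sum.cong[OF refl], rule sum.swap)
  finally show ?thesis
    by (simp add: inner_tensor mult.commute)
qed

text \<open>
  \<open>algE C D X1 k X R Q\<close>: the algorithm generates a k-th iterate, with values X, R, Q of the variables
  carrying the index k. The premise \<open>Q \<noteq> 0\<close> of the second rule makes the divisions meaningful (HOL
  has x / 0 = 0): with \<open>R \<noteq> 0\<close> and \<open>Q = 0\<close> the algorithm would break down, and no further iterate
  would be generated.
\<close>

inductive algE ::
    "('n1::finite, 'n2::finite, 'n3::finite) tensor \<Rightarrow> ('n1, 'l::finite, 'n3) tensor \<Rightarrow>
     ('n2, 'l, 'n3) tensor \<Rightarrow> nat \<Rightarrow>
     ('n2, 'l, 'n3) tensor \<Rightarrow> ('n2, 'l, 'n3) tensor \<Rightarrow> ('n2, 'l, 'n3) tensor \<Rightarrow> bool"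
  for C D X1 where
  init: "R1 = ttranspose C \<star> D - ttranspose C \<star> C \<star> X1 \<Longrightarrow>
    P1 = ttranspose C \<star> C \<star> R1 \<Longrightarrow>
    algE C D X1 1 X1 R1 P1"
| step: "algE C D X1 k X R Q \<Longrightarrow> R \<noteq> 0 \<Longrightarrow> Q \<noteq> 0 \<Longrightarrow>
    X' = X + ((norm R)\<^sup>2 / (norm Q)\<^sup>2) *\<^sub>R Q \<Longrightarrow>
    R' = ttranspose C \<star> D - ttranspose C \<star> C \<star> X' \<Longrightarrow>
    P' = ttranspose C \<star> C \<star> R' \<Longrightarrow>
    Q' = P' - (trace ((ttranspose P' \<star> Q) $ 0) / (norm Q)\<^sup>2) *\<^sub>R Q \<Longrightarrow>
    algE C D X1 (Suc k) X' R' Q'"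

definition algE_output ::
    "('n1::finite, 'n2::finite, 'n3::finite) tensor \<Rightarrow> ('n1, 'l::finite, 'n3) tensor \<Rightarrow>
     ('n2, 'l, 'n3) tensor \<Rightarrow> ('n2, 'l, 'n3) tensor \<Rightarrow> bool" where
  "algE_output C D X1 X \<longleftrightarrow> (\<exists>k Q. algE C D X1 k X 0 Q)"

definition lsq_solution ::
    "('n1::finite, 'n2::finite, 'n3::finite) tensor \<Rightarrow> ('n1, 'l::finite, 'n3) tensor \<Rightarrow>
     ('n2, 'l, 'n3) tensor \<Rightarrow> bool" where
  "lsq_solution C D = is_arg_min (\<lambda>X. norm (C \<star> X - D)) (\<lambda>_. True)"

definition min_norm_lsq_solution ::
    "('n1::finite, 'n2::finite, 'n3::finite) tensor \<Rightarrow> ('n1, 'l::finite, 'n3) tensor \<Rightarrow>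
     ('n2, 'l, 'n3) tensor \<Rightarrow> bool" where
  "min_norm_lsq_solution C D = is_arg_min norm (lsq_solution C D)"

end

theory Submission
  imports Defs
begin

text \<open>
  Put \<open>M Z = C\<^sup>T \<star> C \<star> Z\<close> and \<open>b = C\<^sup>T \<star> D\<close>. Minimizers of the residual are the solutions of the
  normal equation \<open>M X = b\<close>, which is consistent, and \<open>M\<close> is self-adjoint. Let \<open>S\<close> be the span of
  the residuals before step \<open>k\<close>. By induction \<open>R\<^sub>k\<close> is orthogonal to \<open>S\<close>, \<open>Q\<^sub>k\<close> lies in
  \<open>M (R\<^sub>k + S)\<close> and is orthogonal to \<open>M S\<close>, and \<open>M (M S)\<close> is contained in the span of \<open>S\<close> and
  \<open>R\<^sub>k\<close>. So the residuals are pairwise orthogonal, and one of the first \<open>n\<^sub>2 l n\<^sub>3 + 1\<close> of them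
  vanishes. There is no breakdown before, as \<open>Q\<^sub>k \<bullet> (X\<^sup>* - X\<^sub>k) = R\<^sub>k \<bullet> R\<^sub>k\<close> for every solution \<open>X\<^sup>*\<close>.
  If \<open>X\<^sub>1\<close> is in the range of \<open>M\<close>, then so is every iterate, and a solution in the range of \<open>M\<close> is
  orthogonal to its difference from any other solution.
\<close>

section \<open>Least squares and the normal equation\<close>

text \<open>Splitting \<open>d\<close> along the range of \<open>f\<close> leaves a part
  \<open>z\<close> orthogonal to that range, and the adjoint kills such a \<open>z\<close>.\<close>

lemma normal_equation_solvable:
  fixes f :: "'a::euclidean_space \<Rightarrow> 'b::euclidean_space"
  assumes "linear f"
  shows "\<exists>x. adjoint f (f x) = adjoint f d"
proof -
  have sub: "span (range f) = range f"
    using assms by (simp add: linear_subspace_image span_eq_iff)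
  obtain y z where "y \<in> range f" and z: "\<And>w. w \<in> range f \<Longrightarrow> orthogonal z w" and d: "d = y + z"
    using orthogonal_subspace_decomp_exists[of "range f" d] unfolding sub by metis
  then obtain x where y: "y = f x" by blast
  have "w \<bullet> adjoint f z = 0" for w
    using z[of "f w"] by (simp add: adjoint_works[OF assms] orthogonal_def inner_commute)
  then have "adjoint f z = 0"
    using inner_eq_zero_iff by blast
  then have "adjoint f (f x) = adjoint f d"
    by (simp add: d y linear_add[OF adjoint_linear[OF assms]])
  then show ?thesis ..
qed

text \<open>The normal equation says that \<open>f x - d\<close> is orthogonal to the range of
  \<open>f\<close>, which contains \<open>f y - f x\<close>.\<close>

lemma residual_pythagoras:
  fixes f :: "'a::euclidean_space \<Rightarrow> 'b::euclidean_space"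
  assumes "linear f" and x: "adjoint f (f x) = adjoint f d"
  shows "(norm (f y - d))\<^sup>2 = (norm (f x - d))\<^sup>2 + (norm (f y - f x))\<^sup>2"
proof -
  have "(y - x) \<bullet> adjoint f (f x - d) = 0"
    by (simp add: x linear_diff[OF adjoint_linear[OF assms(1)]])
  then have "(f y - f x) \<bullet> (f x - d) = 0"
    by (simp add: adjoint_works[OF assms(1)] linear_diff[OF assms(1)])
  then have "orthogonal (f x - d) (f y - f x)"
    by (simp add: orthogonal_def inner_commute)
  from norm_add_Pythagorean[OF this] show ?thesis by simp
qed

lemma is_arg_min_residual_iff:
  fixes f :: "'a::euclidean_space \<Rightarrow> 'b::euclidean_space"
  assumes "linear f"
  shows "is_arg_min (\<lambda>x. norm (f x - d)) (\<lambda>_. True) x \<longleftrightarrow> adjoint f (f x) = adjoint f d"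
proof
  assume x: "adjoint f (f x) = adjoint f d"
  have "norm (f x - d) \<le> norm (f y - d)" for y
    using residual_pythagoras[OF assms x, of y] by (intro power2_le_imp_le[OF _ norm_ge_zero]) simp
  then show "is_arg_min (\<lambda>x. norm (f x - d)) (\<lambda>_. True) x"
    by (simp add: is_arg_min_linorder)
next
  assume "is_arg_min (\<lambda>x. norm (f x - d)) (\<lambda>_. True) x"
  \<comment> \<open>Comparing the minimizer with some solution \<open>z\<close> of the normal
    equation leaves no room for \<open>norm (f x - f z)\<close>.\<close>
  moreover obtain z where z: "adjoint f (f z) = adjoint f d"
    using normal_equation_solvable[OF assms] by blast
  ultimately have "norm (f x - d) \<le> norm (f z - d)"
    by (simp add: is_arg_min_linorder)
  then have "(norm (f x - d))\<^sup>2 \<le> (norm (f z - d))\<^sup>2"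
    by (simp add: power_mono)
  then have "f x = f z"
    using residual_pythagoras[OF assms z, of x] by simp
  with z show "adjoint f (f x) = adjoint f d" by simp
qed

lemma self_adjoint_solution_pythagoras:
  fixes M :: "'a::real_inner \<Rightarrow> 'a"
  assumes "linear M" and self_adjoint: "\<And>x y. M x \<bullet> y = x \<bullet> M y"
    and "x \<in> range M" "M x = M y"
  shows "(norm y)\<^sup>2 = (norm x)\<^sup>2 + (norm (y - x))\<^sup>2"
proof -
  obtain h where "x = M h" using assms(3) by blast
  then have "orthogonal x (y - x)"
    using assms(4) by (simp add: orthogonal_def self_adjoint linear_diff[OF assms(1)])
  from norm_add_Pythagorean[OF this] show ?thesis by simp
qed

section \<open>The residual recursion\<close>

text \<open>\<open>A\<close> is the set of the residuals before \<open>R\<close>.\<close>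

definition residual_inv :: "('a::real_inner \<Rightarrow> 'a) \<Rightarrow> 'a \<Rightarrow> 'a \<Rightarrow> 'a set \<Rightarrow> bool" where
  "residual_inv M R Q A \<longleftrightarrow>
    pairwise orthogonal A \<and> 0 \<notin> A \<and> (\<forall>a\<in>A. orthogonal R a) \<and> (\<forall>a\<in>A. orthogonal Q (M a)) \<and>
    (\<exists>s\<in>span A. Q = M (R + s)) \<and> (\<forall>a\<in>A. M (M a) \<in> span (insert R A))"

lemma residual_inv_init: "residual_inv M R (M R) {}"
  by (simp add: residual_inv_def)

lemma orthogonal_to_linear_image_span:
  fixes Q :: "'a::real_inner"
  assumes "linear M" "\<And>a. a \<in> A \<Longrightarrow> orthogonal Q (M a)" "s \<in> span A"
  shows "Q \<bullet> M s = 0"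
  using orthogonal_to_span[of "M s" "M ` A" Q] assms
  by (auto simp: orthogonal_def linear_span_image)

lemma linear_image_span_subset:
  assumes "linear M" "\<And>a. a \<in> A \<Longrightarrow> M a \<in> span B" "s \<in> span A"
  shows "M s \<in> span B"
  using assms span_minimal[of "M ` A" "span B"] by (auto simp: linear_span_image)

text \<open>Moving \<open>M\<close> from \<open>Q = M (R + s)\<close> onto \<open>e\<close> gives
  \<open>(R + s) \<bullet> R\<close>, and \<open>s\<close> is orthogonal to \<open>R\<close>. With
  the error \<open>e\<close> of the iterate this rules out breakdown.\<close>

lemma residual_inv_inner:
  assumes "linear M" and self_adjoint: "\<And>x y. M x \<bullet> y = x \<bullet> M y"
    and "residual_inv M R Q A" and R: "R = M e"
  shows "Q \<bullet> e = R \<bullet> R"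
proof -
  obtain s where s: "s \<in> span A" and Q: "Q = M (R + s)"
    using assms(3) unfolding residual_inv_def by blast
  have "R \<bullet> s = 0"
    using orthogonal_to_span[OF s, of R] assms(3) by (auto simp: residual_inv_def orthogonal_def)
  then show ?thesis
    unfolding Q self_adjoint R[symmetric] by (simp add: inner_simps inner_commute)
qed

text \<open>The two coefficients make \<open>R'\<close> orthogonal to \<open>R\<close> and
  \<open>Q'\<close> to \<open>Q\<close>. Orthogonality to older vectors is inherited, with
  \<open>M (M a)\<close> confined to the span of residuals orthogonal to \<open>R'\<close>.\<close>

lemma residual_inv_step:
  assumes lin: "linear M" and self_adjoint: "\<And>x y. M x \<bullet> y = x \<bullet> M y"
    and inv: "residual_inv M R Q A" and "R \<noteq> 0" "Q \<noteq> 0"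
    and R': "R' = R - ((norm R)\<^sup>2 / (norm Q)\<^sup>2) *\<^sub>R M Q"
    and Q': "Q' = M R' - ((M R' \<bullet> Q) / (norm Q)\<^sup>2) *\<^sub>R Q"
  shows "residual_inv M R' Q' (insert R A)"
proof -
  define \<alpha> where "\<alpha> = (norm R)\<^sup>2 / (norm Q)\<^sup>2"
  define \<beta> where "\<beta> = (M R' \<bullet> Q) / (norm Q)\<^sup>2"
  have \<alpha>: "\<alpha> \<noteq> 0" "\<alpha> * (Q \<bullet> Q) = R \<bullet> R"
    using \<open>R \<noteq> 0\<close> \<open>Q \<noteq> 0\<close> by (simp_all add: \<alpha>_def power2_norm_eq_inner)
  have \<beta>: "\<beta> * (Q \<bullet> Q) = M R' \<bullet> Q"
    using \<open>Q \<noteq> 0\<close> by (simp add: \<beta>_def power2_norm_eq_inner)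
  have A: "pairwise orthogonal A" "0 \<notin> A" and RA: "\<And>a. a \<in> A \<Longrightarrow> orthogonal R a"
    and QA: "\<And>a. a \<in> A \<Longrightarrow> orthogonal Q (M a)"
    and MM: "\<And>a. a \<in> A \<Longrightarrow> M (M a) \<in> span (insert R A)"
    using inv by (simp_all add: residual_inv_def)
  obtain s where s: "s \<in> span A" and Q: "Q = M (R + s)"
    using inv unfolding residual_inv_def by blast
  have s': "s \<in> span (insert R A)"
    using s span_mono[of A "insert R A"] by blast
  have MR: "M R = Q - M s"
    by (simp add: Q linear_add[OF lin])
  have QMs: "Q \<bullet> M s = 0"
    using orthogonal_to_linear_image_span[OF lin QA s] .
  have R'A: "orthogonal R' a" if "a \<in> A" for a
    using RA[OF that] QA[OF that] self_adjoint[of Q a]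
    by (simp add: orthogonal_def R' inner_diff_left)
  \<comment> \<open>Here \<open>M R = Q - M s\<close> with \<open>Q\<close> orthogonal to
    \<open>M s\<close>; so \<alpha> is exactly the coefficient that cancels
    \<open>R' \<bullet> R\<close>.\<close>
  have "M Q \<bullet> R = Q \<bullet> Q"
    by (simp add: self_adjoint MR inner_diff_right QMs)
  then have R'R: "orthogonal R' R"
    using \<alpha>(2) by (simp add: orthogonal_def R' inner_diff_left flip: \<alpha>_def)
  have R'_span: "orthogonal R' v" if "v \<in> span (insert R A)" for v
    using orthogonal_to_span[OF that, of R'] R'A R'R by auto
  \<comment> \<open>Self-adjointness turns \<open>M R' \<bullet> M a\<close> into
    \<open>R' \<bullet> M (M a)\<close>, which vanishes by the span condition on
    \<open>M (M a)\<close>.\<close>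
  have Q'A: "orthogonal Q' (M a)" if "a \<in> A" for a
    using QA[OF that] R'_span[OF MM[OF that]] self_adjoint[of R' "M a"]
    by (simp add: orthogonal_def Q' inner_diff_left)
  have "Q' \<bullet> Q = 0"
    using \<beta> by (simp add: Q' inner_diff_left flip: \<beta>_def)
  moreover have "Q' \<bullet> M s = 0"
    using orthogonal_to_linear_image_span[OF lin Q'A s] .
  ultimately have Q'R: "orthogonal Q' (M R)"
    by (simp add: orthogonal_def MR inner_diff_right)
  \<comment> \<open>The witness comes from substituting \<open>Q = M (R + s)\<close> into
    \<open>Q' = M R' - \<beta> Q\<close>.\<close>
  have "- \<beta> *\<^sub>R (R + s) \<in> span (insert R A)"
    by (intro span_mul span_add s' span_base insertI1)
  moreover have "Q' = M (R' + - \<beta> *\<^sub>R (R + s))"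
    by (simp only: linear_add[OF lin, of R'] linear_cmul[OF lin] Q[symmetric])
       (simp add: Q' \<beta>_def)
  ultimately have Q'_ex: "\<exists>t\<in>span (insert R A). Q' = M (R' + t)" ..
  let ?B = "insert R' (insert R A)"
  have sub: "span (insert R A) \<subseteq> span ?B"
    by (intro span_mono) blast
  \<comment> \<open>The residual update is solved for \<open>M Q\<close>, which is possible because
    \<alpha> is nonzero.\<close>
  have "M Q = (1 / \<alpha>) *\<^sub>R (R - R')"
    using \<alpha>(1) by (simp add: R' flip: \<alpha>_def)
  then have "M Q \<in> span ?B"
    by (simp add: span_mul span_diff span_base)
  moreover have "M (M s) \<in> span (insert R A)"
    using linear_image_span_subset[of "M \<circ> M", OF linear_compose[OF lin lin] _ s] MM by simp
  moreover have "M (M R) = M Q - M (M s)"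
    by (simp add: MR linear_diff[OF lin])
  ultimately have MMR: "M (M R) \<in> span ?B"
    using sub span_diff by fastforce
  have "pairwise orthogonal (insert R A)"
    using A RA by (auto simp: pairwise_insert orthogonal_commute)
  moreover have "0 \<notin> insert R A"
    using A(2) \<open>R \<noteq> 0\<close> by blast
  moreover have "\<forall>a\<in>insert R A. orthogonal R' a"
    using R'A R'R by blast
  moreover have "\<forall>a\<in>insert R A. orthogonal Q' (M a)"
    using Q'A Q'R by blast
  moreover have "\<forall>a\<in>insert R A. M (M a) \<in> span ?B"
    using MM sub MMR by blast
  ultimately show ?thesis
    unfolding residual_inv_def using Q'_ex by blast
qed

section \<open>The T-product\<close>

lemma matrix_sum_ldistrib:
  fixes A :: "'a::semiring_1 ^ 'p ^ 'm"
  shows "A ** (\<Sum>j\<in>J. f j) = (\<Sum>j\<in>J. A ** f j)"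
  by (induction J rule: infinite_finite_induct) (simp_all add: matrix_add_ldistrib)

lemma matrix_add_rdistrib: "(A + B) ** E = A ** E + B ** E"
  by (vector matrix_matrix_mult_def sum.distrib[symmetric] field_simps)

lemma matrix_sum_rdistrib:
  fixes B :: "'a::semiring_1 ^ 'p ^ 'm"
  shows "(\<Sum>j\<in>J. f j) ** B = (\<Sum>j\<in>J. f j ** B)"
  by (induction J rule: infinite_finite_induct) (simp_all add: matrix_add_rdistrib)

lemma transpose_sum: "transpose (\<Sum>j\<in>J. f j) = (\<Sum>j\<in>J. transpose (f j))"
  by (simp add: transpose_def vec_eq_iff)

lemma sum_mod_ring_shift:
  fixes f :: "'q::finite mod_ring \<Rightarrow> 'a::comm_monoid_add"
  shows "(\<Sum>j\<in>UNIV. f j) = (\<Sum>j\<in>UNIV. f (j - k))"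
  by (rule sum.reindex_bij_witness[of _ "\<lambda>j. j - k" "\<lambda>j. j + k"]) auto

text \<open>This is associativity of matrix-valued convolution over a cyclic group: shift the inner
  index by \<open>j\<close>, then swap the sums.\<close>

lemma tprod_assoc: "(A \<star> B) \<star> E = A \<star> (B \<star> E)"
proof -
  have "(\<Sum>j\<in>UNIV. \<Sum>i\<in>UNIV. A $ (k - j - i) ** B $ i ** E $ j) =
      (\<Sum>i\<in>UNIV. \<Sum>j\<in>UNIV. A $ (k - i) ** (B $ (i - j) ** E $ j))" for k
  proof -
    have "(\<Sum>i\<in>UNIV. A $ (k - j - i) ** B $ i ** E $ j) =
        (\<Sum>i\<in>UNIV. A $ (k - i) ** (B $ (i - j) ** E $ j))" for j
      by (subst sum_mod_ring_shift[where k = j]) (simp add: matrix_mul_assoc algebra_simps)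
    then have "(\<Sum>j\<in>UNIV. \<Sum>i\<in>UNIV. A $ (k - j - i) ** B $ i ** E $ j) =
        (\<Sum>j\<in>UNIV. \<Sum>i\<in>UNIV. A $ (k - i) ** (B $ (i - j) ** E $ j))"
      by (simp only:)
    also have "\<dots> = (\<Sum>i\<in>UNIV. \<Sum>j\<in>UNIV. A $ (k - i) ** (B $ (i - j) ** E $ j))"
      by (rule sum.swap)
    finally show ?thesis .
  qed
  then show ?thesis
    by (simp add: tprod_def matrix_sum_rdistrib matrix_sum_ldistrib)
qed

lemma ttranspose_ttranspose: "ttranspose (ttranspose A) = A"
  by (simp add: ttranspose_def vec_eq_iff)

lemma ttranspose_tprod: "ttranspose (A \<star> B) = ttranspose B \<star> ttranspose A"
proof -
  have "(\<Sum>j\<in>UNIV. transpose (B $ j) ** transpose (A $ (- k - j))) =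
      (\<Sum>j\<in>UNIV. transpose (B $ (- (k - j))) ** transpose (A $ (- j)))" for k
    by (subst sum_mod_ring_shift[where k = k]) (simp add: algebra_simps)
  then show ?thesis
    by (simp add: ttranspose_def tprod_def transpose_sum matrix_transpose_mul)
qed

lemma linear_tprod:
  fixes A :: "('m::finite, 'p::finite, 'q::finite) tensor"
  shows "linear ((\<star>) A :: ('p, 's::finite, 'q) tensor \<Rightarrow> _)"
proof (rule linearI)
  fix X Y :: "('p, 's, 'q) tensor" and c :: real
  show "A \<star> (X + Y) = A \<star> X + A \<star> Y"
    by (subst vec_eq_iff) (simp add: tprod_def matrix_add_ldistrib sum.distrib)
  have "(\<Sum>j\<in>UNIV. A $ (k - j) ** (c *\<^sub>R X $ j)) = c *\<^sub>R (\<Sum>j\<in>UNIV. A $ (k - j) ** X $ j)" for k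
    by (simp only: scaleR_sum_right matrix_scalar_ac scalar_matrix_assoc)
  then show "A \<star> (c *\<^sub>R X) = c *\<^sub>R (A \<star> X)"
    by (subst vec_eq_iff) (simp add: tprod_def)
qed

text \<open>Both sides are the trace of the first slice of
  \<open>ttranspose E \<star> A \<star> B\<close>.\<close>

lemma inner_tprod: "(A \<star> B) \<bullet> E = B \<bullet> (ttranspose A \<star> E)"
  by (simp add: inner_tensor_trace ttranspose_tprod ttranspose_ttranspose tprod_assoc)

lemma adjoint_tprod: "adjoint ((\<star>) A) = (\<star>) (ttranspose A)"
  by (rule adjoint_unique) (simp add: inner_tprod)

lemma gram_tprod_self_adjoint: "(ttranspose A \<star> A \<star> X) \<bullet> Y = X \<bullet> (ttranspose A \<star> A \<star> Y)"
  by (simp add: inner_tprod ttranspose_tprod ttranspose_ttranspose)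

section \<open>Least-squares solutions for tensors\<close>

lemma normal_equation_tensor_solvable: "\<exists>X. ttranspose A \<star> A \<star> X = ttranspose A \<star> D"
  using normal_equation_solvable[OF linear_tprod, of A D] by (simp add: adjoint_tprod tprod_assoc)

lemma lsq_solution_iff: "lsq_solution C D X \<longleftrightarrow> ttranspose C \<star> C \<star> X = ttranspose C \<star> D"
  by (simp add: lsq_solution_def is_arg_min_residual_iff linear_tprod adjoint_tprod tprod_assoc)

lemma min_norm_lsq_solution_unique:
  assumes X: "lsq_solution C D X" "X \<in> range ((\<star>) (ttranspose C \<star> C))"
  shows "min_norm_lsq_solution C D Y \<longleftrightarrow> Y = X"
proof -
  have pyth: "(norm Z)\<^sup>2 = (norm X)\<^sup>2 + (norm (Z - X))\<^sup>2" if "lsq_solution C D Z" for Z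
    by (rule self_adjoint_solution_pythagoras[OF linear_tprod gram_tprod_self_adjoint X(2)])
       (use X that in \<open>simp add: lsq_solution_iff\<close>)
  have le: "norm X \<le> norm Z" if "lsq_solution C D Z" for Z
    using pyth[OF that] by (intro power2_le_imp_le[OF _ norm_ge_zero]) simp
  show ?thesis
  proof
    assume "min_norm_lsq_solution C D Y"
    then have Y: "lsq_solution C D Y" "norm Y \<le> norm X"
      using X by (auto simp: min_norm_lsq_solution_def is_arg_min_linorder)
    then show "Y = X"
      using pyth[OF Y(1)] le[OF Y(1)] by simp
  qed (use X le in \<open>simp add: min_norm_lsq_solution_def is_arg_min_linorder\<close>)
qed

section \<open>Algorithm E\<close>

lemma algE_residual: "algE C D X1 k X R Q \<Longrightarrow> R = ttranspose C \<star> D - ttranspose C \<star> C \<star> X"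
  by (induction rule: algE.induct) auto

lemma algE_inv:
  assumes "algE C D X1 k X R Q"
  shows "\<exists>A. finite A \<and> Suc (card A) = k \<and> residual_inv ((\<star>) (ttranspose C \<star> C)) R Q A"
  using assms
proof (induction rule: algE.induct)
  case (init R1 P1)
  then show ?case
    using residual_inv_init by (intro conjI exI[of _ "{}"]) auto
next
  case (step k X R Q X' R' P' Q')
  let ?M = "(\<star>) (ttranspose C \<star> C)"
  obtain A where A: "finite A" "Suc (card A) = k" "residual_inv ?M R Q A"
    using step.IH by blast
  \<comment> \<open>The algorithm recomputes the residual from \<open>X'\<close>; linearity turns
    this into the recursion of \<open>residual_inv_step\<close>.\<close>
  have "R' = R - ((norm R)\<^sup>2 / (norm Q)\<^sup>2) *\<^sub>R ?M Q"
    using algE_residual[OF step.hyps(1)]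
    by (simp add: step.hyps linear_add[OF linear_tprod] linear_cmul[OF linear_tprod])
  then have "residual_inv ?M R' Q' (insert R A)"
    by (rule residual_inv_step[OF linear_tprod gram_tprod_self_adjoint A(3) step.hyps(2,3)])
       (simp only: step.hyps(6,7) inner_tensor_trace[symmetric] inner_commute[of Q])
  \<comment> \<open>A nonzero vector is not orthogonal to itself, so \<open>R\<close> is new and the
    cardinality grows with \<open>k\<close>.\<close>
  moreover have "R \<notin> A"
    using A(3) \<open>R \<noteq> 0\<close> by (auto simp: residual_inv_def orthogonal_def)
  ultimately show ?case
    using A by (intro conjI exI[of _ "insert R A"]) auto
qed

lemma algE_no_breakdown:
  assumes "algE C D X1 k X R Q" "R \<noteq> 0"
  shows "Q \<noteq> 0"
proof -
  let ?M = "(\<star>) (ttranspose C \<star> C)"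
  obtain Z where "?M Z = ttranspose C \<star> D"
    using normal_equation_tensor_solvable by blast
  then have "R = ?M (Z - X)"
    using algE_residual[OF assms(1)] by (simp add: linear_diff[OF linear_tprod])
  moreover obtain A where "residual_inv ?M R Q A"
    using algE_inv[OF assms(1)] by blast
  ultimately have "Q \<bullet> (Z - X) = R \<bullet> R"
    by (intro residual_inv_inner[OF linear_tprod gram_tprod_self_adjoint])
  with \<open>R \<noteq> 0\<close> show ?thesis by auto
qed

text \<open>Together with \<open>R\<close>, the \<open>k - 1\<close> earlier residuals are
  \<open>k\<close> nonzero pairwise orthogonal vectors, hence independent.\<close>

lemma algE_index_le:
  assumes "algE C D (X1 :: ('n2::finite, 'l::finite, 'n3::finite) tensor) k X R Q" "R \<noteq> 0"
  shows "k \<le> CARD('n2) * CARD('l) * CARD('n3)"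
proof -
  obtain A where A: "finite A" "Suc (card A) = k"
    and inv: "residual_inv ((\<star>) (ttranspose C \<star> C)) R Q A"
    using algE_inv[OF assms(1)] by blast
  have "pairwise orthogonal (insert R A)" "0 \<notin> insert R A" "R \<notin> A"
    using inv \<open>R \<noteq> 0\<close>
    by (auto simp: residual_inv_def pairwise_insert orthogonal_commute orthogonal_def)
  then have "card (insert R A) \<le> DIM(('n2, 'l, 'n3) tensor)"
    by (intro independent_card_le pairwise_orthogonal_independent)
  then show ?thesis
    using A \<open>R \<notin> A\<close> by (simp add: ac_simps)
qed

lemma algE_terminates:
  fixes X1 :: "('n2::finite, 'l::finite, 'n3::finite) tensor"
  shows "\<exists>k\<in>{1..CARD('n2) * CARD('l) * CARD('n3) + 1}. \<exists>X Q. algE C D X1 k X 0 Q"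
proof (rule ccontr)
  let ?N = "CARD('n2) * CARD('l) * CARD('n3)"
  assume none: "\<not> ?thesis"
  \<comment> \<open>Iterates are numbered from 1, so \<open>k\<close> counts updates. Nonzero
    residuals up to there would let the run reach iterate \<open>?N + 1\<close>, beyond the
    dimension bound.\<close>
  have "k \<le> ?N \<Longrightarrow> \<exists>X R Q. algE C D X1 (Suc k) X R Q" for k
  proof (induction k)
    case 0
    show ?case using algE.init[OF refl refl, of C D X1] by auto
  next
    case (Suc k)
    then obtain X R Q where alg: "algE C D X1 (Suc k) X R Q" by auto
    with none Suc.prems have "R \<noteq> 0" by auto
    from algE.step[OF alg this algE_no_breakdown[OF alg this] refl refl refl refl]
    show ?case by blast
  qed
  then obtain X R Q where alg: "algE C D X1 (Suc ?N) X R Q" by blast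
  with none have "R \<noteq> 0" by auto
  with algE_index_le[OF alg] show False by simp
qed

text \<open>Each \<open>Q\<close> is an image under \<open>M\<close>, so every update stays in the
  subspace \<open>range M\<close>, with \<open>M\<close> the map
  \<open>(\<star>) (ttranspose C \<star> C)\<close>.\<close>

lemma algE_iterate_in_range:
  assumes "algE C D X1 k X R Q" "X1 \<in> range ((\<star>) (ttranspose C \<star> C))"
  shows "X \<in> range ((\<star>) (ttranspose C \<star> C))"
  using assms(1)
proof (induction rule: algE.induct)
  case (step k X R Q X' R' P' Q')
  have "Q \<in> range ((\<star>) (ttranspose C \<star> C))"
    using algE_inv[OF step.hyps(1)] by (auto simp: residual_inv_def)
  then show ?case
    unfolding step.hyps
    by (intro subspace_add subspace_mul linear_subspace_image linear_tprod subspace_UNIV step.IH)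
qed (rule assms(2))

theorem theorem5p4:
  fixes C :: "('n1::finite, 'n2::finite, 'n3::finite) tensor"
    and D :: "('n1, 'l::finite, 'n3) tensor"
  shows "(\<forall>X1 :: ('n2, 'l, 'n3) tensor.
      \<exists>k\<in>{1..CARD('n2) * CARD('l) * CARD('n3) + 1}.
        \<exists>X R Q. algE C D X1 k X R Q \<and> lsq_solution C D X) \<and>
    (\<forall>X1 :: ('n2, 'l, 'n3) tensor.
      (\<exists>H. X1 = ttranspose C \<star> C \<star> H) \<or> X1 = 0 \<longrightarrow>
      (\<exists>X. algE_output C D X1 X) \<and>
      (\<forall>X. algE_output C D X1 X \<longrightarrow>
        min_norm_lsq_solution C D X \<and>
        (\<forall>Y. min_norm_lsq_solution C D Y \<longrightarrow> Y = X)))"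
proof (intro conjI allI impI)
  fix X1 :: "('n2, 'l, 'n3) tensor"
  \<comment> \<open>A vanishing residual is the normal equation.\<close>
  have sol: "lsq_solution C D X" if "algE C D X1 k X 0 Q" for k X Q
    using algE_residual[OF that] by (simp add: lsq_solution_iff)
  show "\<exists>k\<in>{1..CARD('n2) * CARD('l) * CARD('n3) + 1}.
      \<exists>X R Q. algE C D X1 k X R Q \<and> lsq_solution C D X"
    using algE_terminates[of C D X1] sol by blast
  show "\<exists>X. algE_output C D X1 X"
    using algE_terminates[of C D X1] by (auto simp: algE_output_def)
  assume "(\<exists>H. X1 = ttranspose C \<star> C \<star> H) \<or> X1 = 0"
  \<comment> \<open>The zero start is covered as the image of 0.\<close>
  then have X1: "X1 \<in> range ((\<star>) (ttranspose C \<star> C))"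
    using linear_0[OF linear_tprod, of "ttranspose C \<star> C"] by (metis rangeI)
  fix X
  assume "algE_output C D X1 X"
  then obtain k Q where alg: "algE C D X1 k X 0 Q"
    by (auto simp: algE_output_def)
  note unique = min_norm_lsq_solution_unique[OF sol[OF alg] algE_iterate_in_range[OF alg X1]]
  show "min_norm_lsq_solution C D X"
    by (simp add: unique)
  show "Y = X" if "min_norm_lsq_solution C D Y" for Y
    using that by (simp add: unique)
qed

end
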